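(* Let $\mathbf{P}$ be an ideal hyperbolic triangle with hyperbolic barycenter $S_{\mathbf{P}}$, and let $\Gamma_{\mathbf{P}}$ be the conic through the six polars $P_1^*,P_2^*,P_3^*,\hat P_1^*,\hat P_2^*,\hat P_3^*$. Then the set $\mathcal{M}_3(S_{\mathbf{P}})$ of ideal triangles having $S_{\mathbf{P}}$ as their hyperbolic barycenter consists exactly of the ideal triangles $\mathbf{Q}$ whose ideal vertices are the points of tangency with $\mathbf{O}$ of a triangle that is inscribed in $\Gamma_{\mathbf{P}}$ and circumscribed about $\mathbf{O}$ (this triangle being the polar triangle $Q_1^*Q_2^*Q_3^*$ of $\mathbf{Q}$). Moreover, the conic $\Gamma_{\mathbf{P}}$ depends only on $S_{\mathbf{P}}$ and not on $\mathbf{P}$: if $\mathbf{P}'$ is another ideal triangle with $S_{\mathbf{P}'}=S_{\mathbf{P}}$, then $\Gamma_{\mathbf{P}'}=\Gamma_{\mathbf{P}}$.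
   Context: $\mathbb{H}$ is the open unit disc in the Klein–Beltrami model (geodesics are open chords), with absolute the unit circle $\mathbf{O}$. All points, lines and conics are considered in the real projective plane containing $\mathbb{R}^2$. An ideal triangle $\mathbf{P}$ has three distinct vertices $P_1,P_2,P_3\in\mathbf{O}$ and sides $\xi_\ell=P_\ell P_{\ell+1}$ (indices modulo $3$); triangles are considered up to relabelling of vertices. The polar $P_\ell^*$ to the side $\xi_\ell$ is the intersection point (possibly at infinity) of the tangent lines to $\mathbf{O}$ at $P_\ell$ and $P_{\ell+1}$. The hyperbolic barycenter $S_{\mathbf{P}}\in\mathbb{H}$ of an ideal triangle is its symmedian point, i.e. the common point of the lines $P_{\ell-1}P_\ell^*$, $\ell=1,2,3$ (equivalently its hyperbolic orthocenter). The ideal triangle $\hat{\mathbf{P}}$ associated with $\mathbf{P}$ has vertices $\hat P_\ell$, where $\hat P_\ell\in\mathbf{O}$ is the image of $P_\ell$ under hyperbolic reflection in the opposite side $\xi_{\ell+1}=P_{\ell+1}P_{\ell+2}$, and $\hat P_\ell^*$ is the polar to the side $\hat P_\ell\hat P_{\ell+1}$. The six points $P_1^*,P_2^*,P_3^*,\hat P_1^*,\hat P_2^*,\hat P_3^*$ lie on a unique conic, denoted $\Gamma_{\mathbf{P}}$. A triangle is circumscribed about $\mathbf{O}$ if its three side lines are tangent to $\mathbf{O}$. *)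

theory Defs
  imports "HOL-Analysis.Analysis"
begin

section \<open>The real projective plane\<close>

typedef rp2 = "{W :: (real^3) set. subspace W \<and> dim W = 1}"
proof
  show "span {axis 1 1 :: real^3} \<in> {W. subspace W \<and> dim W = 1}"
    by (simp add: dim_insert axis_eq_0_iff)
qed

definition affine_pt :: "real^2 \<Rightarrow> rp2"
  where "affine_pt x = Abs_rp2 (span {vector [x$1, x$2, 1]})"

definition proj_line :: "rp2 set \<Rightarrow> bool"
  where "proj_line L \<longleftrightarrow> (\<exists>W. subspace W \<and> dim W = 2 \<and> L = {X. Rep_rp2 X \<subseteq> W})"

text \<open>A projective line only if the two points are distinct; otherwise just that point.\<close>

definition line_through :: "rp2 \<Rightarrow> rp2 \<Rightarrow> rp2 set"
  where "line_through X Y = {Z. Rep_rp2 Z \<subseteq> span (Rep_rp2 X \<union> Rep_rp2 Y)}"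

text \<open>Degenerate conics are admitted, so that uniqueness of a conic through given points is
  uniqueness among all conics.\<close>

definition conic :: "rp2 set \<Rightarrow> bool"
  where "conic C \<longleftrightarrow> (\<exists>A :: real^3^3. A \<noteq> 0 \<and> transpose A = A \<and>
           C = {X. \<forall>v \<in> Rep_rp2 X. v \<bullet> (A *v v) = 0})"

section \<open>The absolute, tangents and polars\<close>

definition absolute :: "rp2 set"
  where "absolute = affine_pt ` sphere 0 1"

text \<open>A line is tangent to a circle iff it has exactly one point in common with it.\<close>

definition tangent_line :: "rp2 set \<Rightarrow> bool"
  where "tangent_line L \<longleftrightarrow> proj_line L \<and> (\<exists>X. L \<inter> absolute = {X})"

definition tangent_at :: "real^2 \<Rightarrow> rp2 set"
  where "tangent_at x = (THE L. proj_line L \<and> L \<inter> absolute = {affine_pt x})"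

definition polar_of_chord :: "real^2 \<Rightarrow> real^2 \<Rightarrow> rp2"
  where "polar_of_chord x y = (THE Z. Z \<in> tangent_at x \<inter> tangent_at y)"

section \<open>Reflections of the Klein--Beltrami model\<close>

definition klein_disc :: "(real^2) set"
  where "klein_disc = ball 0 1"

definition klein_dist :: "real^2 \<Rightarrow> real^2 \<Rightarrow> real"
  where "klein_dist x y = arcosh ((1 - x \<bullet> y) / sqrt ((1 - x \<bullet> x) * (1 - y \<bullet> y)))"

definition klein_isometry :: "(real^2 \<Rightarrow> real^2) \<Rightarrow> bool"
  where "klein_isometry f \<longleftrightarrow> bij_betw f klein_disc klein_disc \<and>
           (\<forall>x\<in>klein_disc. \<forall>y\<in>klein_disc. klein_dist (f x) (f y) = klein_dist x y)"

definition klein_reflection :: "(real^2) set \<Rightarrow> (real^2 \<Rightarrow> real^2) \<Rightarrow> bool"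
  where "klein_reflection g f \<longleftrightarrow> klein_isometry f \<and> {x \<in> klein_disc. f x = x} = g"

text \<open>A reflection is determined by its geodesic only on the open disc; at an ideal point it
  is taken by continuous extension.\<close>

definition reflect_ideal :: "(real^2) set \<Rightarrow> real^2 \<Rightarrow> real^2"
  where "reflect_ideal g x =
           (THE y. \<exists>f. klein_reflection g f \<and> (f \<longlongrightarrow> y) (at x within klein_disc))"

section \<open>Ideal triangles\<close>

text \<open>Vertices are indexed by the type \<open>3\<close>, whose arithmetic is that of the integers
  modulo 3.\<close>

definition ideal_triangle :: "(3 \<Rightarrow> real^2) \<Rightarrow> bool"
  where "ideal_triangle P \<longleftrightarrow> inj P \<and> range P \<subseteq> sphere 0 1"

definition polar :: "(3 \<Rightarrow> real^2) \<Rightarrow> 3 \<Rightarrow> rp2"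
  where "polar P l = polar_of_chord (P l) (P (l + 1))"

definition barycenter :: "(3 \<Rightarrow> real^2) \<Rightarrow> real^2"
  where "barycenter P = (THE S. S \<in> klein_disc \<and>
           (\<forall>l. affine_pt S \<in> line_through (affine_pt (P (l - 1))) (polar P l)))"

definition hat :: "(3 \<Rightarrow> real^2) \<Rightarrow> 3 \<Rightarrow> real^2"
  where "hat P l = reflect_ideal (open_segment (P (l + 1)) (P (l + 2))) (P l)"

definition Gamma_conic :: "(3 \<Rightarrow> real^2) \<Rightarrow> rp2 set"
  where "Gamma_conic P = (THE C. conic C \<and> range (polar P) \<union> range (polar (hat P)) \<subseteq> C)"

text \<open>Triangles up to relabelling are represented by their vertex sets.\<close>

definition M3 :: "real^2 \<Rightarrow> (real^2) set set"
  where "M3 S = {range Q | Q. ideal_triangle Q \<and> barycenter Q = S}"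

section \<open>Inscribed and circumscribed triangles\<close>

definition proj_triangle :: "(3 \<Rightarrow> rp2) \<Rightarrow> bool"
  where "proj_triangle T \<longleftrightarrow> \<not> (\<exists>L. proj_line L \<and> range T \<subseteq> L)"

definition inscribed_in :: "(3 \<Rightarrow> rp2) \<Rightarrow> rp2 set \<Rightarrow> bool"
  where "inscribed_in T C \<longleftrightarrow> range T \<subseteq> C"

definition side_line :: "(3 \<Rightarrow> rp2) \<Rightarrow> 3 \<Rightarrow> rp2 set"
  where "side_line T l = line_through (T l) (T (l + 1))"

definition circumscribed_about_absolute :: "(3 \<Rightarrow> rp2) \<Rightarrow> bool"
  where "circumscribed_about_absolute T \<longleftrightarrow> (\<forall>l. tangent_line (side_line T l))"

text \<open>Meaningful for circumscribed triangles, where each side meets the absolute only in its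
  point of tangency.\<close>

definition tangency_points :: "(3 \<Rightarrow> rp2) \<Rightarrow> rp2 set"
  where "tangency_points T = (\<Union>l. side_line T l \<inter> absolute)"

definition poncelet_triangle :: "rp2 set \<Rightarrow> (3 \<Rightarrow> rp2) \<Rightarrow> bool"
  where "poncelet_triangle C T \<longleftrightarrow>
           proj_triangle T \<and> inscribed_in T C \<and> circumscribed_about_absolute T"

end

theory Submission
  imports Defs
begin

text \<open>The disc is read in the space $\mathbb{R}^{2,1}$: a point $x$ of the affine plane becomes the
  vector $(x,1)$ of \<open>homog\<close>, polarity in the absolute becomes orthogonality for the form
  \<open>mink\<close>, ideal points are the null directions and points of the disc the timelike ones.

  The idea is to rescale the three null vectors of an ideal triangle to $q_1, q_2, q_3$ whose
  pairwise products all have the same value $-D$ (\<open>balanced_frame\<close>). They form a basis, and in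
  it every ideal triangle looks the same: the polar of a side is $q_1 + q_2 - q_3$ up to the
  choice of indices, the barycenter is $s = q_1 + q_2 + q_3$, and reflecting a vertex gives
  $2 q_2 + 2 q_3 - q_1$. The reflected vectors are again balanced, with constant $9D$.

  A conic is determined by the three polars, of coordinates $(1,1,-1)$, together with the three
  polars of the associated triangle, of coordinates $(-1,-1,5)$: the six linear conditions on a
  quadratic form leave only the multiples of
  $x^2 + y^2 + z^2 + 3(xy + yz + zx)$ (\<open>conic_through_polars_unique\<close>). Without coordinates this
  form is $\langle v,v\rangle\langle s,s\rangle + 3\langle v,s\rangle^2$ up to a factor, which
  mentions only the barycenter. Hence $\Gamma_{\mathbf P}$ depends only on the barycenter
  (\<open>Gamma_conic_eq\<close>); for the centre of the disc it is the concentric circle of radius 2.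

  Conversely, suppose the polars of $\mathbf Q$ lie on the conic belonging to a point $S$ of the
  disc, and expand $S$ in the balanced frame of $\mathbf Q$. The three incidences say that the
  coordinates have equal squares, and the signs must agree because otherwise $S$ would not be
  timelike; so $S$ is the barycenter of $\mathbf Q$ (\<open>center_determined_by_polars\<close>). Finally, a
  triangle circumscribed about the absolute with tangency points the vertices of $\mathbf Q$ can
  only be the polar triangle of $\mathbf Q$, since each of its vertices is the intersection of two
  of the three tangents (\<open>tangency_determines_triangle\<close>).\<close>

section \<open>Indices modulo 3\<close>

lemma three_arith:
  fixes l :: 3
  shows "l + 1 + 1 = l + 2" "l + 1 + 2 = l" "l + 2 + 1 = l" "l + 2 + 2 = l + 1" "l - 1 = l + 2"
    and "l + 1 \<noteq> l" "l + 2 \<noteq> l" "l + 1 \<noteq> l + 2" "l \<noteq> l + 1" "l \<noteq> l + 2" "l + 2 \<noteq> l + 1"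
  using exhaust_3[of l] by (elim disjE; simp)+

lemma three_cases:
  fixes l :: 3
  shows "(l = 1 \<and> l + 1 = 2 \<and> l + 2 = 3) \<or> (l = 2 \<and> l + 1 = 3 \<and> l + 2 = 1) \<or>
    (l = 3 \<and> l + 1 = 1 \<and> l + 2 = 2)"
  using exhaust_3[of l] by (elim disjE; simp)

lemma range_shift3: "range (\<lambda>l :: 3. f (l + 1)) = range f"
proof -
  have "f m = f (m + 2 + 1)" for m by (simp only: three_arith)
  then show ?thesis by blast
qed

section \<open>The Minkowski form and homogeneous coordinates\<close>

definition mink :: "real^3 \<Rightarrow> real^3 \<Rightarrow> real"
  where "mink u v = u$1 * v$1 + u$2 * v$2 - u$3 * v$3"

lemma mink_simps [simp]:
  "mink (u + v) w = mink u w + mink v w" "mink w (u + v) = mink w u + mink w v"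
  "mink (u - v) w = mink u w - mink v w" "mink w (u - v) = mink w u - mink w v"
  "mink (a *\<^sub>R u) w = a * mink u w" "mink w (a *\<^sub>R u) = a * mink w u"
  "mink (- u) w = - mink u w" "mink w (- u) = - mink w u"
  "mink 0 w = 0" "mink w 0 = 0"
  by (simp_all add: mink_def algebra_simps)

lemma mink_commute: "mink u v = mink v u"
  by (simp add: mink_def mult.commute)

text \<open>Applying the matrix of \<^term>\<open>mink\<close>: it translates between lines given by their
  Euclidean normals and lines given by their poles.\<close>

definition flip3 :: "real^3 \<Rightarrow> real^3"
  where "flip3 u = vector [u$1, u$2, - u$3]"

lemma mink_eq_inner: "mink u v = flip3 u \<bullet> v"
  by (simp add: mink_def flip3_def inner_vec_def sum_3)

lemma flip3_flip3 [simp]: "flip3 (flip3 u) = u"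
  by (simp add: flip3_def vec_eq_iff forall_3)

lemma flip3_0 [simp]: "flip3 u = 0 \<longleftrightarrow> u = 0"
  by (auto simp: flip3_def vec_eq_iff forall_3)

definition homog :: "real^2 \<Rightarrow> real^3"
  where "homog x = vector [x$1, x$2, 1]"

definition dehomog :: "real^3 \<Rightarrow> real^2"
  where "dehomog v = vector [v$1 / v$3, v$2 / v$3]"

lemma homog_nth [simp]: "homog x $ 1 = x$1" "homog x $ 2 = x$2" "homog x $ 3 = 1"
  by (simp_all add: homog_def)

lemma homog_nonzero [simp]: "homog x \<noteq> 0"
  by (auto simp: vec_eq_iff forall_3)

lemma mink_homog: "mink (homog x) (homog y) = x \<bullet> y - 1"
  by (simp add: mink_def inner_vec_def sum_2)

lemma dehomog_scale_homog [simp]: "c \<noteq> 0 \<Longrightarrow> dehomog (c *\<^sub>R homog x) = x"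
  by (simp add: dehomog_def vec_eq_iff forall_2)

lemma dehomog_homog [simp]: "dehomog (homog x) = x"
  using dehomog_scale_homog[of 1 x] by simp

lemma homog_dehomog: "v$3 \<noteq> 0 \<Longrightarrow> v = v$3 *\<^sub>R homog (dehomog v)"
  by (simp add: dehomog_def vec_eq_iff forall_3)

definition timelike_future :: "real^3 \<Rightarrow> bool"
  where "timelike_future v \<longleftrightarrow> mink v v < 0 \<and> v$3 > 0"

lemma homog_timelike_iff: "timelike_future (homog x) \<longleftrightarrow> x \<in> klein_disc"
  by (simp add: timelike_future_def mink_homog klein_disc_def norm_lt_square flip: power2_norm_eq_inner)

lemma timelike_future_scale:
  "timelike_future v \<Longrightarrow> c > 0 \<Longrightarrow> timelike_future (c *\<^sub>R v)"
  by (simp add: timelike_future_def mult_pos_neg mult_pos_pos)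

lemma timelike_future_dehomog:
  assumes "timelike_future v"
  shows "dehomog v \<in> klein_disc"
proof -
  have "v$3 > 0" using assms by (simp add: timelike_future_def)
  then have "homog (dehomog v) = inverse (v$3) *\<^sub>R v"
    using homog_dehomog[of v] by (metis less_irrefl real_vector.scale_left_imp_eq scaleR_scaleR right_inverse scaleR_one)
  then show ?thesis
    using timelike_future_scale[OF assms, of "inverse (v$3)"] \<open>v$3 > 0\<close>
    by (simp flip: homog_timelike_iff)
qed

text \<open>Each vector has a spatial part no longer than its time component, so by the Euclidean Cauchy-Schwarz
  inequality the spatial part of the product is smaller than the time part.\<close>

lemma causal_pairing:
  assumes w: "timelike_future w" and u: "mink u u \<le> 0" and u3: "u$3 > 0"
  shows "mink u w < 0"
proof -
  have a: "(u$1)\<^sup>2 + (u$2)\<^sup>2 \<le> (u$3)\<^sup>2" and b: "(w$1)\<^sup>2 + (w$2)\<^sup>2 < (w$3)\<^sup>2" and w3: "w$3 > 0"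
    using assms by (auto simp: mink_def timelike_future_def power2_eq_square)
  have "(u$1 * w$1 + u$2 * w$2)\<^sup>2 \<le> ((u$1)\<^sup>2 + (u$2)\<^sup>2) * ((w$1)\<^sup>2 + (w$2)\<^sup>2)"
    using sum_squares_ge_zero[of 0 "u$1 * w$2 - u$2 * w$1"]
    by (simp add: power2_eq_square algebra_simps)
  also have "\<dots> \<le> (u$3)\<^sup>2 * ((w$1)\<^sup>2 + (w$2)\<^sup>2)"
    by (rule mult_right_mono[OF a]) simp
  also have "\<dots> < (u$3)\<^sup>2 * (w$3)\<^sup>2"
    using b u3 by (intro mult_strict_left_mono) auto
  finally have "(u$1 * w$1 + u$2 * w$2)\<^sup>2 < (u$3 * w$3)\<^sup>2" by (simp add: power_mult_distrib)
  then have "u$1 * w$1 + u$2 * w$2 < u$3 * w$3"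
    using u3 w3 by (metis less_eq_real_def mult_pos_pos power2_less_imp_less)
  then show ?thesis by (simp add: mink_def)
qed

text \<open>The half of the cone can be read off from a product, which an isometry of the form preserves; this
  is how reflections are seen to map the disc to itself.\<close>

lemma causal_future:
  assumes w: "timelike_future w" and u: "mink u u \<le> 0" and neg: "mink u w < 0"
  shows "u$3 > 0"
proof (rule ccontr)
  assume "\<not> u$3 > 0"
  then consider "u$3 = 0" | "(- u)$3 > 0" by fastforce
  then show False
  proof cases
    case 1
    then have "u$1 * u$1 + u$2 * u$2 \<le> 0" using u by (simp add: mink_def)
    then have "u$1 = 0 \<and> u$2 = 0"
      by (meson sum_squares_le_zero_iff)
    with 1 neg show False by (simp add: mink_def)
  next
    case 2
    have "mink (- u) w < 0" by (rule causal_pairing[OF w _ 2]) (simp add: u)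
    with neg show False by simp
  qed
qed

text \<open>Hyperbolic distances are \<^const>\<open>arcosh\<close> of a quotient; this inequality puts that quotient in the
  range where \<^const>\<open>arcosh\<close> is injective.\<close>

lemma reversed_cauchy_schwarz:
  assumes "timelike_future u" "timelike_future w"
  shows "mink u u * mink w w \<le> (mink u w)\<^sup>2"
proof -
  have ww: "mink w w < 0" and w3: "w$3 > 0" and u3: "u$3 > 0" 
    using assms by (auto simp: timelike_future_def)
  \<comment> \<open>A combination of the two vectors with vanishing time component is spacelike.\<close>
  define z where "z = w$3 *\<^sub>R u - u$3 *\<^sub>R w"
  have "z$3 = 0" by (simp add: z_def)
  then have 0: "mink z z \<ge> 0" by (simp add: mink_def)
  have "0 \<ge> mink z z * mink w w" using 0 ww by (simp add: mult_nonneg_nonpos)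
  also have "mink z z * mink w w = (u$3 * mink w w - w$3 * mink u w)\<^sup>2 + (w$3)\<^sup>2 * (mink u u * mink w w - (mink u w)\<^sup>2)"
    by (simp add: z_def mink_commute[of w u] power2_eq_square algebra_simps)
  finally have "(u$3 * mink w w - w$3 * mink u w)\<^sup>2 + (w$3)\<^sup>2 * (mink u u * mink w w - (mink u w)\<^sup>2) \<le> 0" .
  then have "(w$3)\<^sup>2 * (mink u u * mink w w - (mink u w)\<^sup>2) \<le> 0"
    by (smt (verit) zero_le_power2)
  then show ?thesis using w3 by (simp add: mult_le_0_iff)
qed

section \<open>Points, lines and tangents\<close>

definition pt :: "real^3 \<Rightarrow> rp2"
  where "pt v = Abs_rp2 (span {v})"

lemma Rep_pt: "v \<noteq> 0 \<Longrightarrow> Rep_rp2 (pt v) = span {v}"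
  unfolding pt_def by (rule Abs_rp2_inverse) (simp add: dim_insert)

lemma affine_pt_eq: "affine_pt x = pt (homog x)"
  by (simp add: affine_pt_def pt_def homog_def)

lemma rp2_exhaust:
  obtains v where "v \<noteq> 0" "X = pt v"
proof -
  have W: "subspace (Rep_rp2 X)" "dim (Rep_rp2 X) = 1" using Rep_rp2[of X] by auto
  obtain B where B: "B \<subseteq> Rep_rp2 X" "independent B" "Rep_rp2 X \<subseteq> span B" "card B = 1"
    using basis_exists[of "Rep_rp2 X"] W by metis
  obtain v where v: "B = {v}" using B(4) card_1_singletonE by blast
  have "v \<noteq> 0" using B(2) v by auto
  moreover have "Rep_rp2 X = span {v}"
    using B v W(1) by (metis span_minimal subset_antisym)
  then have "X = pt v" unfolding pt_def by (metis Rep_rp2_inverse)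
  ultimately show thesis by (rule that)
qed

lemma pt_eq_iff:
  assumes "v \<noteq> 0" "w \<noteq> 0"
  shows "pt v = pt w \<longleftrightarrow> (\<exists>c. w = c *\<^sub>R v)"
proof
  assume "pt v = pt w"
  then have "span {v} = span {w}" using Rep_pt assms by metis
  then have "w \<in> span {v}" by (metis span_base singletonI)
  then show "\<exists>c. w = c *\<^sub>R v" by (auto simp: span_singleton)
next
  assume "\<exists>c. w = c *\<^sub>R v"
  then obtain c where c: "w = c *\<^sub>R v" by blast
  then have "c \<noteq> 0" using assms by auto
  then have "v = inverse c *\<^sub>R w" using c by simp
  then have "v \<in> span {w}" by (metis span_base span_scale singletonI)
  moreover have "w \<in> span {v}" using c by (simp add: span_base span_scale)
  ultimately have "span {v} = span {w}" by (simp add: span_eq)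
  then show "pt v = pt w" by (simp add: pt_def)
qed

lemma pt_scale [simp]: "c \<noteq> 0 \<Longrightarrow> pt (c *\<^sub>R v) = pt v"
  by (cases "v = 0") (auto simp: pt_eq_iff intro: exI[of _ "inverse c"])

lemma affine_pt_eq_iff: "affine_pt x = affine_pt y \<longleftrightarrow> x = y"
proof
  assume "affine_pt x = affine_pt y"
  then obtain c where c: "homog y = c *\<^sub>R homog x"
    by (auto simp: affine_pt_eq pt_eq_iff)
  then have "c = 1" by (metis homog_nth(3) vector_scaleR_component mult.right_neutral real_scaleR_def)
  then show "x = y" using c by (metis dehomog_homog scaleR_one)
qed simp

text \<open>Lines are named by their poles with respect to the absolute, so that the tangent at an ideal
  point is named by that point itself.\<close>

definition polar_line :: "real^3 \<Rightarrow> rp2 set"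
  where "polar_line n = {X. \<forall>v\<in>Rep_rp2 X. mink n v = 0}"

lemma pt_in_polar_line: "v \<noteq> 0 \<Longrightarrow> pt v \<in> polar_line n \<longleftrightarrow> mink n v = 0"
  by (auto simp: polar_line_def Rep_pt span_singleton)

lemma affine_in_polar_line: "affine_pt x \<in> polar_line n \<longleftrightarrow> mink n (homog x) = 0"
  by (simp add: affine_pt_eq pt_in_polar_line)

lemma polar_line_scale: "c \<noteq> 0 \<Longrightarrow> polar_line (c *\<^sub>R n) = polar_line n"
  by (simp add: polar_line_def)

lemma proj_line_iff: "proj_line L \<longleftrightarrow> (\<exists>n. n \<noteq> 0 \<and> L = polar_line n)"
proof
  assume "proj_line L"
  then obtain W where W: "subspace W" "dim W = 2" "L = {X. Rep_rp2 X \<subseteq> W}"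
    by (auto simp: proj_line_def)
  then obtain a where a: "a \<noteq> 0" "span W = {x. a \<bullet> x = 0}"
    using dim_eq_hyperplane[of W] by auto
  have "W = {x. mink (flip3 a) x = 0}" 
    using a(2) W(1) by (simp add: mink_eq_inner) (metis span_eq_iff)
  then have "L = polar_line (flip3 a)" using W(3) by (auto simp: polar_line_def)
  with a(1) show "\<exists>n. n \<noteq> 0 \<and> L = polar_line n" by (metis flip3_0)
next
  assume "\<exists>n. n \<noteq> 0 \<and> L = polar_line n"
  then obtain n where n: "n \<noteq> 0" "L = polar_line n" by blast
  have "L = {X. Rep_rp2 X \<subseteq> {x. flip3 n \<bullet> x = 0}}"
    using n by (auto simp: polar_line_def mink_eq_inner)
  moreover have "dim {x. flip3 n \<bullet> x = 0} = 2"
    using dim_hyperplane[of "flip3 n"] n by simp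
  ultimately show "proj_line L"
    unfolding proj_line_def using subspace_hyperplane by blast
qed

lemma pt_in_line_through:
  assumes "u \<noteq> 0" "v \<noteq> 0" "w \<noteq> 0"
  shows "pt w \<in> line_through (pt u) (pt v) \<longleftrightarrow> (\<exists>a b. w = a *\<^sub>R u + b *\<^sub>R v)"
proof -
  have "span (span {u} \<union> span {v}) = span {u, v}"
    unfolding span_eq by (auto intro: span_base span_mono[THEN subsetD, of "{_}"])
  moreover have "span {w} \<subseteq> span {u, v} \<longleftrightarrow> w \<in> span {u, v}"
    by (meson span_base singletonI subsetD empty_subsetI insert_subset span_minimal subspace_span)
  ultimately have "pt w \<in> line_through (pt u) (pt v) \<longleftrightarrow> w \<in> span {u, v}"
    using assms by (simp add: line_through_def Rep_pt)
  also have "\<dots> \<longleftrightarrow> (\<exists>a b. w = a *\<^sub>R u + b *\<^sub>R v)"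
    by (simp add: span_breakdown_eq span_singleton image_iff) (metis add.commute diff_add_cancel add_diff_cancel_left')
  finally show ?thesis .
qed

lemma in_absolute_iff: "X \<in> absolute \<longleftrightarrow> (\<exists>x. norm x = 1 \<and> X = affine_pt x)"
  by (auto simp: absolute_def)

lemma homog_null: "norm x = 1 \<Longrightarrow> mink (homog x) (homog x) = 0"
  by (simp add: mink_homog norm_eq_1)

lemma mink_homog_neg:
  assumes "norm x = 1" "norm y = 1" "x \<noteq> y"
  shows "mink (homog x) (homog y) < 0"
proof -
  have "0 < (x - y) \<bullet> (x - y)" using assms(3) by simp
  then show ?thesis
    using assms(1,2) by (simp add: mink_homog norm_eq_1 algebra_simps inner_commute)
qed

lemma polar_line_homog_absolute:
  assumes "norm x = 1"
  shows "polar_line (homog x) \<inter> absolute = {affine_pt x}"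
  using assms mink_homog_neg[OF assms] homog_null
  by (force simp: in_absolute_iff affine_in_polar_line)

text \<open>In the affine chart the line has a Euclidean normal $m$, and the reflection of $x$ in the direction
  of $m$ is a second common point with the circle. Tangency forces the two points to coincide,
  which makes $x$ a multiple of $m$.\<close>

lemma tangent_normal:
  assumes n: "n \<noteq> 0" and x: "norm x = 1" and eq: "polar_line n \<inter> absolute = {affine_pt x}"
  shows "\<exists>c. c \<noteq> 0 \<and> n = c *\<^sub>R homog x"
proof -
  \<comment> \<open>The points y of the line are those with m \<bullet> y = n$3.\<close>
  define m :: "real^2" where "m = vector [n$1, n$2]"
  have mn: "mink n (homog y) = m \<bullet> y - n$3" for y
    by (simp add: m_def mink_def inner_vec_def sum_2)
  have mx: "m \<bullet> x = n$3"
    using eq affine_in_polar_line[of x n] by (auto simp: mn)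
  have m0: "m \<bullet> m \<noteq> 0"
  proof
    assume "m \<bullet> m = 0"
    then have "m = 0" by simp
    then have "n$3 = 0" using mx by simp
    with \<open>m = 0\<close> n show False by (auto simp: m_def vec_eq_iff forall_2 forall_3)
  qed
  define y where "y = (2 * n$3 / (m \<bullet> m)) *\<^sub>R m - x"
  have "y \<bullet> y = 1"
    using mx m0 x by (simp add: y_def norm_eq_1 inner_diff_left inner_diff_right inner_commute[of x m] field_simps)
  then have "norm y = 1" by (simp add: norm_eq_1)
  moreover have "m \<bullet> y = n$3"
    using mx m0 by (simp add: y_def inner_diff_right)
  then have "affine_pt y \<in> polar_line n" by (simp add: affine_in_polar_line mn)
  ultimately have "affine_pt y \<in> {affine_pt x}"
    unfolding eq[symmetric] by (auto simp: in_absolute_iff)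
  then have "y = x" by (simp add: affine_pt_eq_iff)
  then have "2 *\<^sub>R x = 2 *\<^sub>R ((n$3 / (m \<bullet> m)) *\<^sub>R m)"
    by (simp add: y_def scaleR_2 algebra_simps)
  then have xm: "x = (n$3 / (m \<bullet> m)) *\<^sub>R m" by (metis real_vector.scale_left_imp_eq zero_neq_numeral)
  have n3: "n$3 \<noteq> 0" using xm x by auto
  have "x \<bullet> x = (n$3)\<^sup>2 / (m \<bullet> m)"
    unfolding xm by (simp add: power2_eq_square m0)
  then have "(n$3)\<^sup>2 = m \<bullet> m" using x m0 by (simp add: norm_eq_1)
  then have "m = n$3 *\<^sub>R x"
    using xm n3 m0 by (simp add: power2_eq_square)
  then have "m$1 = n$3 * x$1" "m$2 = n$3 * x$2" by auto
  then have "n = n$3 *\<^sub>R homog x"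
    by (simp add: m_def vec_eq_iff forall_3)
  with n3 show ?thesis by blast
qed

lemma tangent_at_eq:
  assumes "norm x = 1"
  shows "tangent_at x = polar_line (homog x)"
  unfolding tangent_at_def
proof (rule the_equality)
  show "proj_line (polar_line (homog x)) \<and> polar_line (homog x) \<inter> absolute = {affine_pt x}"
    using assms polar_line_homog_absolute homog_nonzero unfolding proj_line_iff by blast
  fix L assume "proj_line L \<and> L \<inter> absolute = {affine_pt x}"
  then show "L = polar_line (homog x)"
    using tangent_normal[OF _ assms] polar_line_scale by (metis proj_line_iff)
qed

lemma tangent_line_iff: "tangent_line L \<longleftrightarrow> (\<exists>x. norm x = 1 \<and> L = polar_line (homog x))"
proof
  assume "tangent_line L"
  then obtain X where L: "proj_line L" "L \<inter> absolute = {X}" by (auto simp: tangent_line_def)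
  then obtain x where x: "norm x = 1" "X = affine_pt x" by (auto simp: in_absolute_iff set_eq_iff)
  obtain n where n: "n \<noteq> 0" "L = polar_line n" using L(1) by (auto simp: proj_line_iff)
  obtain k where "k \<noteq> 0" "n = k *\<^sub>R homog x"
    using tangent_normal[OF n(1) x(1)] L(2) n(2) x(2) by blast
  then have "L = polar_line (homog x)" using n(2) by (simp add: polar_line_scale)
  with x(1) show "\<exists>x. norm x = 1 \<and> L = polar_line (homog x)" by blast
next
  assume "\<exists>x. norm x = 1 \<and> L = polar_line (homog x)"
  then show "tangent_line L"
    unfolding tangent_line_def proj_line_iff using polar_line_homog_absolute homog_nonzero by blast
qed

section \<open>Balanced frames\<close>

text \<open>Null vectors over the vertices with equal pairwise products. The frame carries the threefold
  symmetry of the ideal triangle: in its coordinates no vertex is distinguished and all products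
  are given by one formula.\<close>

locale balanced_frame =
  fixes P :: "3 \<Rightarrow> real^2" and q :: "3 \<Rightarrow> real^3" and c :: "3 \<Rightarrow> real" and D :: real
  assumes norm_P: "norm (P l) = 1"
    and c_pos: "c l > 0"
    and q_eq: "q l = c l *\<^sub>R homog (P l)"
    and D_pos: "D > 0"
    and balanced: "l \<noteq> m \<Longrightarrow> mink (q l) (q m) = - D"
begin

lemma inj_P: "inj P"
proof (rule injI, rule ccontr)
  fix l m assume "P l = P m" "l \<noteq> m"
  then have "c l * (c m * mink (homog (P m)) (homog (P m))) = - D"
    using balanced[of l m] by (simp add: q_eq mult.left_commute)
  then show False using D_pos homog_null[OF norm_P, of m] by simp
qed

lemma q_null [simp]: "mink (q l) (q l) = 0"
  by (simp add: q_eq homog_null norm_P)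

text \<open>Coordinates start at an arbitrary index, so that a statement about one vertex or side gives the
  statements about the other two by \<open>comb_rotate\<close>.\<close>

definition comb :: "3 \<Rightarrow> real \<Rightarrow> real \<Rightarrow> real \<Rightarrow> real^3"
  where "comb l x y z = x *\<^sub>R q l + y *\<^sub>R q (l + 1) + z *\<^sub>R q (l + 2)"

lemma comb_rotate: "comb (l + 1) x y z = comb l z x y" "comb (l + 2) x y z = comb l y z x"
  by (simp_all add: comb_def three_arith)

lemma mink_comb:
  "mink (comb l x y z) (comb l x' y' z') = - D * (x * y' + x * z' + y * x' + y * z' + z * x' + z * y')"
  by (simp add: comb_def balanced three_arith algebra_simps)

lemma comb_arith:
  "comb l x y z + comb l x' y' z' = comb l (x + x') (y + y') (z + z')"
  "comb l x y z - comb l x' y' z' = comb l (x - x') (y - y') (z - z')"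
  "a *\<^sub>R comb l x y z = comb l (a * x) (a * y) (a * z)"
  by (simp_all add: comb_def algebra_simps)

lemma comb_eq_0 [simp]: "comb l x y z = 0 \<longleftrightarrow> x = 0 \<and> y = 0 \<and> z = 0"
proof
  assume 0: "comb l x y z = 0"
  have "mink (comb l x y z) (comb l (-1) 1 1) = -2 * D * x" "mink (comb l x y z) (comb l 1 (-1) 1) = -2 * D * y"
    "mink (comb l x y z) (comb l 1 1 (-1)) = -2 * D * z"
    unfolding mink_comb by (simp_all add: algebra_simps)
  then show "x = 0 \<and> y = 0 \<and> z = 0" using D_pos 0 by simp
qed (simp add: comb_def)

lemma comb_eq_iff: "comb l x y z = comb l x' y' z' \<longleftrightarrow> x = x' \<and> y = y' \<and> z = z'"
  using comb_eq_0[of l "x - x'" "y - y'" "z - z'"] by (simp flip: comb_arith(2))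

lemma q_comb: "q l = comb l 1 0 0" "q (l + 1) = comb l 0 1 0" "q (l + 2) = comb l 0 0 1"
  by (simp_all add: comb_def)

lemma mink_q_comb:
  "mink (q l) (comb l x y z) = - D * (y + z)"
  "mink (q (l + 1)) (comb l x y z) = - D * (x + z)"
  "mink (q (l + 2)) (comb l x y z) = - D * (x + y)"
  by (simp_all only: q_comb[of l] mink_comb) (simp_all add: algebra_simps)

text \<open>Pairing with $-q_1 + q_2 + q_3$ and its rotations recovers the coordinates, so the frame is linearly
  independent and, in dimension 3, spans.\<close>

lemma comb_exhaust: obtains x y z where "v = comb l x y z"
proof -
  have ne: "q l \<noteq> q (l + 1)" "q l \<noteq> q (l + 2)" "q (l + 1) \<noteq> q (l + 2)"
    by (simp_all add: q_comb[of l] comb_eq_iff)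
  have "independent {q l, q (l + 1), q (l + 2)}"
    unfolding independent_explicit
  proof (intro conjI allI impI ballI)
    fix u w assume u: "(\<Sum>v\<in>{q l, q (l + 1), q (l + 2)}. u v *\<^sub>R v) = 0" and w: "w \<in> {q l, q (l + 1), q (l + 2)}"
    then have "comb l (u (q l)) (u (q (l + 1))) (u (q (l + 2))) = 0"
      using ne by (simp add: comb_def add.assoc)
    with w show "u w = 0" by auto
  qed auto
  moreover have "card {q l, q (l + 1), q (l + 2)} = 3" using ne by simp
  ultimately have "UNIV \<subseteq> span {q l, q (l + 1), q (l + 2)}"
    by (intro card_ge_dim_independent) auto
  then have "v \<in> span {q l, q (l + 1), q (l + 2)}" by auto
  then obtain x y z where "v - x *\<^sub>R q l - y *\<^sub>R q (l + 1) = z *\<^sub>R q (l + 2)"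
    by (auto simp: span_breakdown_eq span_singleton)
  then have "v = comb l x y z" by (simp add: comb_def algebra_simps)
  then show thesis by (rule that)
qed

lemma affine_P: "affine_pt (P l) = pt (q l)"
  using c_pos[of l] by (simp add: affine_pt_eq q_eq)

lemma tangent_at_P: "tangent_at (P l) = polar_line (q l)"
  using c_pos[of l] by (simp add: tangent_at_eq norm_P q_eq polar_line_scale)

lemma tangents_meet:
  "X \<in> tangent_at (P l) \<inter> tangent_at (P (l + 1)) \<longleftrightarrow> X = pt (comb l 1 1 (-1))"
proof -
  obtain v where v: "v \<noteq> 0" "X = pt v" by (rule rp2_exhaust)
  obtain x y z where xyz: "v = comb l x y z" by (rule comb_exhaust)
  have "X \<in> tangent_at (P l) \<inter> tangent_at (P (l + 1)) \<longleftrightarrow> y + z = 0 \<and> x + z = 0"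
    unfolding v(2) Int_iff tangent_at_P pt_in_polar_line[OF v(1)] unfolding xyz mink_q_comb using D_pos by simp
  also have "\<dots> \<longleftrightarrow> (\<exists>a. v = a *\<^sub>R comb l 1 1 (-1))"
    by (auto simp: xyz comb_arith comb_eq_iff)
  also have "\<dots> \<longleftrightarrow> X = pt (comb l 1 1 (-1))"
    using v by (metis comb_eq_0 pt_eq_iff zero_neq_one)
  finally show ?thesis .
qed

lemma polar_eq: "polar P l = pt (comb l 1 1 (-1))"
  unfolding polar_def polar_of_chord_def tangents_meet by simp

section \<open>The polar triangle and the barycenter\<close>

definition center :: "real^3"
  where "center = q 1 + q 2 + q 3"

lemma center_eq: "center = comb l 1 1 1"
  using three_cases[of l]
  by (elim disjE conjE; simp only: center_def comb_def; simp)

lemma center_future: "timelike_future center"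
proof -
  have "mink center center < 0"
    unfolding center_eq[of 1] mink_comb using D_pos by simp
  moreover have "center $ 3 > 0"
    using c_pos[of 1] c_pos[of 2] c_pos[of 3] by (simp add: center_def q_eq)
  ultimately show ?thesis by (simp add: timelike_future_def)
qed

lemma altitude_iff:
  "pt v \<in> line_through (affine_pt (P (l - 1))) (polar P l) \<longleftrightarrow>
     (\<exists>x z. v = comb l x x z)" if "v \<noteq> 0"
proof -
  obtain x y z where xyz: "v = comb l x y z" by (rule comb_exhaust)
  have "pt v \<in> line_through (affine_pt (P (l - 1))) (polar P l) \<longleftrightarrow>
     (\<exists>a b. v = a *\<^sub>R comb l 0 0 1 + b *\<^sub>R comb l 1 1 (-1))"
    unfolding three_arith affine_P polar_eq q_comb(3)[of l] using that
    by (subst pt_in_line_through) simp_all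
  also have "\<dots> \<longleftrightarrow> (\<exists>x z. v = comb l x x z)"
  proof
    assume "\<exists>x z. v = comb l x x z"
    then obtain x z where "v = comb l x x z" by blast
    then have "v = (z + x) *\<^sub>R comb l 0 0 1 + x *\<^sub>R comb l 1 1 (-1)"
      by (simp add: comb_arith comb_eq_iff)
    then show "\<exists>a b. v = a *\<^sub>R comb l 0 0 1 + b *\<^sub>R comb l 1 1 (-1)" by blast
  qed (auto simp: comb_arith comb_eq_iff)
  finally show ?thesis .
qed

text \<open>By \<open>altitude_iff\<close> each of the three lines equates two of the coordinates, so the only common point
  has all coordinates equal.\<close>

lemma barycenter_eq: "barycenter P = dehomog center"
  unfolding barycenter_def
proof (rule the_equality)
  have c3: "center $ 3 > 0" using center_future by (simp add: timelike_future_def)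
  then have "affine_pt (dehomog center) = pt center"
    by (metis affine_pt_eq homog_dehomog less_irrefl pt_scale)
  moreover have "center \<noteq> 0" by (simp add: center_eq[of 1])
  moreover have "\<exists>x z. center = comb l x x z" for l using center_eq by blast
  ultimately show "dehomog center \<in> klein_disc \<and>
      (\<forall>l. affine_pt (dehomog center) \<in> line_through (affine_pt (P (l - 1))) (polar P l))"
    using altitude_iff timelike_future_dehomog[OF center_future] by metis
next
  fix S assume S: "S \<in> klein_disc \<and>
     (\<forall>l. affine_pt S \<in> line_through (affine_pt (P (l - 1))) (polar P l))"
  obtain x y z where xyz: "homog S = comb 1 x y z" by (rule comb_exhaust)
  have on: "\<exists>x z. homog S = comb l x x z" for l
    using S altitude_iff[of "homog S" l] by (simp add: affine_pt_eq)
  have "x = y" using on[of 1] by (auto simp: xyz comb_eq_iff)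
  moreover have "y = z" using on[of "1 + 1"] unfolding comb_rotate by (auto simp: xyz comb_eq_iff)
  ultimately have "homog S = x *\<^sub>R center" 
    unfolding center_eq[of 1] by (simp add: xyz comb_arith)
  moreover from this have "x \<noteq> 0" by (metis homog_nonzero scaleR_zero_left)
  ultimately have "center = inverse x *\<^sub>R homog S" by simp
  then show "S = dehomog center" using \<open>x \<noteq> 0\<close> by simp
qed

lemma side_line_polar: "side_line (polar P) l = polar_line (q (l + 1))"
proof (rule set_eqI)
  fix X
  obtain v where v: "v \<noteq> 0" "X = pt v" by (rule rp2_exhaust)
  obtain x y z where xyz: "v = comb l x y z" by (rule comb_exhaust)
  have "X \<in> side_line (polar P) l \<longleftrightarrow> (\<exists>a b. v = a *\<^sub>R comb l 1 1 (-1) + b *\<^sub>R comb l (-1) 1 1)"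
    unfolding side_line_def polar_eq v(2) comb_rotate using v(1)
    by (subst pt_in_line_through) simp_all
  also have "\<dots> \<longleftrightarrow> x + z = 0"
  proof
    assume "x + z = 0"
    then have "v = ((y + x) / 2) *\<^sub>R comb l 1 1 (-1) + ((y - x) / 2) *\<^sub>R comb l (-1) 1 1"
      by (simp add: xyz comb_arith comb_eq_iff field_simps)
    then show "\<exists>a b. v = a *\<^sub>R comb l 1 1 (-1) + b *\<^sub>R comb l (-1) 1 1" by blast
  qed (auto simp: xyz comb_arith comb_eq_iff)
  also have "\<dots> \<longleftrightarrow> X \<in> polar_line (q (l + 1))"
    unfolding v(2) pt_in_polar_line[OF v(1)] unfolding xyz mink_q_comb using D_pos by simp
  finally show "X \<in> side_line (polar P) l \<longleftrightarrow> X \<in> polar_line (q (l + 1))" .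
qed

lemma circumscribed_polar: "circumscribed_about_absolute (polar P)"
  unfolding circumscribed_about_absolute_def side_line_polar tangent_line_iff
  using norm_P c_pos polar_line_scale by (metis less_irrefl q_eq)

lemma tangency_points_polar: "tangency_points (polar P) = affine_pt ` range P"
proof -
  have 1: "side_line (polar P) l \<inter> absolute = {affine_pt (P (l + 1))}" for l
    unfolding side_line_polar using polar_line_homog_absolute[OF norm_P] c_pos[of "l + 1"]
    by (simp add: q_eq polar_line_scale)
  have "tangency_points (polar P) = affine_pt ` range (\<lambda>l. P (l + 1))"
    unfolding tangency_points_def 1 by blast
  then show ?thesis by (simp only: range_shift3)
qed

text \<open>The pole of a line containing all three polars would be orthogonal to each of them, and the product
  with the polar $(1,1,-1)$ is a nonzero multiple of the last coordinate.\<close>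

lemma proj_triangle_polar: "proj_triangle (polar P)"
  unfolding proj_triangle_def
proof
  assume "\<exists>L. proj_line L \<and> range (polar P) \<subseteq> L"
  then obtain n where n: "n \<noteq> 0" "\<And>l. polar P l \<in> polar_line n"
    by (auto simp: proj_line_iff)
  obtain x y z where xyz: "n = comb 1 x y z" by (rule comb_exhaust)
  have o: "mink n (comb l 1 1 (-1)) = 0" for l
    using n(2)[of l] by (simp add: polar_eq pt_in_polar_line)
  have "z = 0" using o[of 1] D_pos unfolding xyz mink_comb by simp
  moreover have "x = 0" using o[of "1 + 1"] D_pos unfolding xyz mink_comb comb_rotate by simp
  moreover have "y = 0" using o[of "1 + 2"] D_pos unfolding xyz mink_comb comb_rotate by simp
  ultimately show False using n(1) xyz by simp
qed

end

text \<open>With $d_{lm}$ minus the product of the vectors over the vertices $l$ and $m$, scaling each vertex by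
  the $d$ of the opposite side turns every product into $-d_{12} d_{23} d_{31}$.\<close>

lemma ideal_triangle_frame:
  assumes "ideal_triangle P"
  obtains q c D where "balanced_frame P q c D"
proof -
  have norm: "norm (P l) = 1" for l using assms by (auto simp: ideal_triangle_def image_subset_iff)
  have inj: "P l = P m \<longleftrightarrow> l = m" for l m using assms by (auto simp: ideal_triangle_def inj_def)
  define d where "d l m = - mink (homog (P l)) (homog (P m))" for l m
  have d: "l \<noteq> m \<Longrightarrow> d l m > 0" for l m
    unfolding d_def using mink_homog_neg[OF norm norm, of l m] by (simp add: inj)
  have dc: "d l m = d m l" for l m unfolding d_def by (simp add: mink_commute)
  define D where "D = d 1 2 * d 2 3 * d 3 1"
  define c where "c l = d (l + 1) (l + 2)" for l
  have "balanced_frame P (\<lambda>l. c l *\<^sub>R homog (P l)) c D"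
  proof
    show "D > 0" by (simp add: D_def d)
    show "c l > 0" for l by (simp add: c_def d three_arith)
    fix l m :: 3 assume "l \<noteq> m"
    then show "mink (c l *\<^sub>R homog (P l)) (c m *\<^sub>R homog (P m)) = - D"
      using three_cases[of l] three_cases[of m]
      by (elim disjE conjE; simp only: c_def D_def; simp add: d_def mink_commute)
  qed (simp_all add: norm)
  then show thesis by (rule that)
qed

section \<open>The conic of a point of the disc\<close>

text \<open>For $s$ the centre of the disc this is the circle of radius 2 about it, and for the other
  timelike $s$ it is an image of that circle under a hyperbolic isometry, because
  the equation is built from the form alone.\<close>

definition center_conic :: "real^3 \<Rightarrow> rp2 set"
  where "center_conic s = {X. \<forall>v\<in>Rep_rp2 X. mink v v * mink s s + 3 * (mink v s)\<^sup>2 = 0}"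

lemma pt_in_center_conic:
  assumes "v \<noteq> 0"
  shows "pt v \<in> center_conic s \<longleftrightarrow> mink v v * mink s s + 3 * (mink v s)\<^sup>2 = 0"
proof -
  have "mink (a *\<^sub>R v) (a *\<^sub>R v) * mink s s + 3 * (mink (a *\<^sub>R v) s)\<^sup>2
      = a\<^sup>2 * (mink v v * mink s s + 3 * (mink v s)\<^sup>2)" for a
    by (simp add: power2_eq_square algebra_simps)
  then have "X = pt v \<Longrightarrow> X \<in> center_conic s \<longleftrightarrow>
      (\<forall>a. a\<^sup>2 * (mink v v * mink s s + 3 * (mink v s)\<^sup>2) = 0)" for X
    using assms by (simp add: center_conic_def Rep_pt span_singleton image_iff del: mink_simps)
  then show ?thesis by (metis mult_eq_0_iff zero_neq_one power_one)
qed

lemma center_conic_scale: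
  assumes "a \<noteq> 0"
  shows "center_conic (a *\<^sub>R s) = center_conic s"
proof -
  have "mink v v * mink (a *\<^sub>R s) (a *\<^sub>R s) + 3 * (mink v (a *\<^sub>R s))\<^sup>2
      = a\<^sup>2 * (mink v v * mink s s + 3 * (mink v s)\<^sup>2)" for v
    by (simp add: power2_eq_square algebra_simps)
  then show ?thesis using assms by (simp add: center_conic_def del: mink_simps)
qed

lemma conic_center_conic:
  assumes "mink s s \<noteq> 0"
  shows "conic (center_conic s)"
proof -
  define s' where "s' = flip3 s"
  define A :: "real^3^3" where
    "A = (\<chi> i j. mink s s * (if i = j then if i = 3 then -1 else 1 else 0) + 3 * s' $ i * s' $ j)"
  have A: "v \<bullet> (A *v v) = mink v v * mink s s + 3 * (mink v s)\<^sup>2" for v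
    by (simp add: A_def s'_def flip3_def matrix_vector_mult_def inner_vec_def sum_3 mink_def
        power2_eq_square algebra_simps)
  have "s \<bullet> (A *v s) = 4 * (mink s s)\<^sup>2" by (simp add: A power2_eq_square)
  then have "A \<noteq> 0" using assms by auto
  moreover have "transpose A = A"
    by (simp add: A_def transpose_def vec_eq_iff)
  ultimately show ?thesis
    unfolding conic_def center_conic_def A[symmetric] by blast
qed

context balanced_frame
begin

lemma comb_in_center_conic:
  assumes "comb l x y z \<noteq> 0"
  shows "pt (comb l x y z) \<in> center_conic center \<longleftrightarrow>
    x\<^sup>2 + y\<^sup>2 + z\<^sup>2 + 3 * (x * y + y * z + z * x) = 0"
proof -
  have "mink (comb l x y z) (comb l x y z) * mink center center + 3 * (mink (comb l x y z) center)\<^sup>2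
     = 12 * D\<^sup>2 * (x\<^sup>2 + y\<^sup>2 + z\<^sup>2 + 3 * (x * y + y * z + z * x))"
    unfolding center_eq[of l] mink_comb by (simp add: power2_eq_square algebra_simps)
  then show ?thesis unfolding pt_in_center_conic[OF assms] using D_pos by simp
qed

lemma polar_in_center_conic: "polar P l \<in> center_conic center"
  unfolding polar_eq by (subst comb_in_center_conic) simp_all

text \<open>Substituting a polar into the equation of the conic of $s$ gives the square of one coordinate of $s$
  as the common value $(xy + yz + zx)/3$, which is positive because $s$ is timelike. If the
  coordinates did not all have the same sign, $xy + yz + zx$ would be negative.\<close>

lemma center_determined_by_polars:
  assumes s: "timelike_future s" and on: "\<And>l. polar P l \<in> center_conic s"
  shows "\<exists>a. a \<noteq> 0 \<and> s = a *\<^sub>R center"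
proof -
  obtain x y z where xyz: "s = comb 1 x y z" by (rule comb_exhaust)
  have ss: "mink s s = - 2 * D * (x * y + y * z + z * x)"
    unfolding xyz mink_comb by (simp add: algebra_simps)
  then have pos: "x * y + y * z + z * x > 0"
    using s D_pos by (simp add: timelike_future_def zero_less_mult_iff)
  have eq: "3 * (2 * D * c)\<^sup>2 = 4 * D\<^sup>2 * (x * y + y * z + z * x)"
    if "comb 1 x y z = comb l a b c" for l a b c
  proof -
    have "mink (comb l 1 1 (-1)) (comb l 1 1 (-1)) * mink s s + 3 * (mink (comb l 1 1 (-1)) s)\<^sup>2 = 0"
      using on[of l] unfolding polar_eq by (subst (asm) pt_in_center_conic) simp_all
    moreover have "mink (comb l 1 1 (-1)) (comb l 1 1 (-1)) = 2 * D" by (simp add: mink_comb)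
    moreover have "mink (comb l 1 1 (-1)) s = - 2 * D * c"
      unfolding xyz that mink_comb by (simp add: algebra_simps)
    ultimately show ?thesis unfolding ss by (simp add: power2_eq_square algebra_simps)
  qed
  define k where "k = (x * y + y * z + z * x) / 3"
  have sq: "c\<^sup>2 = k" if "comb 1 x y z = comb l a b c" for l a b c
  proof -
    have "(4 * D\<^sup>2) * (3 * c\<^sup>2) = (4 * D\<^sup>2) * (x * y + y * z + z * x)"
      using eq[OF that] by (simp add: power_mult_distrib)
    then have "3 * c\<^sup>2 = x * y + y * z + z * x"
      using D_pos by (subst (asm) mult_cancel_left) simp
    then show ?thesis by (simp add: k_def)
  qed
  have "x\<^sup>2 = k" by (rule sq[OF comb_rotate(1)[symmetric]])
  moreover have "y\<^sup>2 = k" by (rule sq[OF comb_rotate(2)[symmetric]])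
  moreover have "z\<^sup>2 = k" by (rule sq[OF refl])
  ultimately have "x\<^sup>2 = z\<^sup>2" "y\<^sup>2 = z\<^sup>2" by auto
  then have "(x = z \<or> x = - z) \<and> (y = z \<or> y = - z)" by (simp add: power2_eq_iff)
  then have "x = z" "y = z" using pos sum_squares_ge_zero[of z 0] by auto
  then have "s = z *\<^sub>R center" 
    unfolding center_eq[of 1] by (simp add: xyz comb_arith)
  moreover have "z \<noteq> 0" using pos \<open>x = z\<close> \<open>y = z\<close> by auto
  ultimately show ?thesis by blast
qed

text \<open>The points $(-1,-1,5)$ and their rotations are the polars of the associated triangle
  (\<open>polar_hat_eq\<close>). The six conditions are solved for the six coefficients of a quadratic form in the
  frame: comparing the three conditions at the polars makes the mixed coefficients equal, and the
  other three fix the diagonal.\<close>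

lemma conic_through_polars_unique:
  assumes C: "conic C" and pts: "\<And>l. polar P l \<in> C" "\<And>l. pt (comb l (-1) (-1) 5) \<in> C"
  shows "C = center_conic center"
proof -
  obtain A :: "real^3^3" where A: "A \<noteq> 0" "transpose A = A" and CA: "C = {X. \<forall>v \<in> Rep_rp2 X. v \<bullet> (A *v v) = 0}"
    using C by (auto simp: conic_def)
  define B where "B u v = u \<bullet> (A *v v)" for u v
  have sym: "B u v = B v u" for u v
    unfolding B_def by (metis A(2) dot_lmul_matrix inner_commute transpose_matrix_vector)
  have lin: "B (u + w) v = B u v + B w v" "B v (u + w) = B v u + B v w"
    "B (a *\<^sub>R u) v = a * B u v" "B v (a *\<^sub>R u) = a * B v u" for u v w a
    by (simp_all add: B_def inner_add_left inner_add_right matrix_vector_right_distrib matrix_vector_mult_scaleR)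
  have on: "pt v \<in> C \<longleftrightarrow> B v v = 0" if "v \<noteq> 0" for v
    using that by (auto simp: CA Rep_pt span_singleton B_def matrix_vector_mult_scaleR)
  define \<alpha> \<beta> \<gamma> where "\<alpha> = B (q 1) (q 1)" and "\<beta> = B (q (1 + 1)) (q (1 + 1))" and "\<gamma> = B (q (1 + 2)) (q (1 + 2))"
  define d e f where "d = B (q (1 + 1)) (q (1 + 2))" and "e = B (q 1) (q (1 + 2))" and "f = B (q 1) (q (1 + 1))"
  have expand: "B (comb 1 x y z) (comb 1 x y z) =
      x\<^sup>2 * \<alpha> + y\<^sup>2 * \<beta> + z\<^sup>2 * \<gamma> + 2 * (y * z * d + x * z * e + x * y * f)" for x y z
    unfolding comb_def lin \<alpha>_def \<beta>_def \<gamma>_def d_def e_def f_def 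
    by (simp only: sym[of "q (1 + 1)" "q 1"] sym[of "q (1 + 2)" "q 1"] sym[of "q (1 + 2)" "q (1 + 1)"])
       (simp add: power2_eq_square algebra_simps)
  have z1: "B (comb l 1 1 (-1)) (comb l 1 1 (-1)) = 0" for l
    using pts(1)[of l] unfolding polar_eq by (subst (asm) on) simp_all
  have z2: "B (comb l (-1) (-1) 5) (comb l (-1) (-1) 5) = 0" for l
    using pts(2)[of l] by (subst (asm) on) simp_all
  have p: "\<alpha> + \<beta> + \<gamma> + 2 * (- d - e + f) = 0" "\<alpha> + \<beta> + \<gamma> + 2 * (d - e - f) = 0"
      "\<alpha> + \<beta> + \<gamma> + 2 * (- d + e - f) = 0"
    using z1[of 1] z1[of "1 + 1"] z1[of "1 + 2"] unfolding comb_rotate expand by simp_all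
  have p': "\<alpha> + \<beta> + 25 * \<gamma> + 2 * (- 5 * d - 5 * e + f) = 0"
      "25 * \<alpha> + \<beta> + \<gamma> + 2 * (d - 5 * e - 5 * f) = 0" "\<alpha> + 25 * \<beta> + \<gamma> + 2 * (- 5 * d + e - 5 * f) = 0"
    using z2[of 1] z2[of "1 + 1"] z2[of "1 + 2"] unfolding comb_rotate expand by simp_all
  have ef: "e = d" "f = d" using p by simp_all
  have "\<alpha> + \<beta> + \<gamma> = 2 * d" using p(1) ef by simp
  then have "3 * \<alpha> = 2 * d" "3 * \<beta> = 2 * d" "3 * \<gamma> = 2 * d" using p' unfolding ef by simp_all
  then have coeffs: "d = 3/2 * \<alpha>" "e = 3/2 * \<alpha>" "f = 3/2 * \<alpha>" "\<beta> = \<alpha>" "\<gamma> = \<alpha>"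
    using ef by simp_all
  have form: "B (comb 1 x y z) (comb 1 x y z) = \<alpha> * (x\<^sup>2 + y\<^sup>2 + z\<^sup>2 + 3 * (x * y + y * z + z * x))" for x y z
    unfolding expand coeffs by (simp add: algebra_simps)
  \<comment> \<open>A vanishing quadratic form has a vanishing symmetric matrix, by polarization.\<close>
  have "\<alpha> \<noteq> 0"
  proof
    assume "\<alpha> = 0"
    have 0: "B v v = 0" for v
      by (rule comb_exhaust[of v 1]) (simp add: form \<open>\<alpha> = 0\<close>)
    have "B u v = 0" for u v
      using 0[of "u + v"] 0[of u] 0[of v] sym[of u v] by (simp add: lin)
    then have "A *v v = 0" for v unfolding B_def by (metis inner_eq_zero_iff)
    then have "A = 0" by (simp add: matrix_eq)
    with A(1) show False by contradiction
  qed
  show ?thesis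
  proof (rule set_eqI)
    fix X
    obtain v where v: "v \<noteq> 0" "X = pt v" by (rule rp2_exhaust)
    obtain x y z where xyz: "v = comb 1 x y z" by (rule comb_exhaust)
    show "X \<in> C \<longleftrightarrow> X \<in> center_conic center"
      using v(1) \<open>\<alpha> \<noteq> 0\<close> unfolding v(2) on[OF v(1)] unfolding xyz
      by (simp only: comb_in_center_conic form mult_eq_0_iff simp_thms)
  qed
qed

end

section \<open>Reflections and the associated triangle\<close>

lemma timelike_future_pairing_neg:
  "timelike_future u \<Longrightarrow> timelike_future w \<Longrightarrow> mink u w < 0"
  using causal_pairing[of w u] by (simp add: timelike_future_def)

text \<open>The argument of \<^const>\<open>arcosh\<close> in the distance, written on vectors: being homogeneous it may be
  evaluated on any positive multiples of the homogeneous coordinates.\<close>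

definition cosh_dist :: "real^3 \<Rightarrow> real^3 \<Rightarrow> real"
  where "cosh_dist u v = - mink u v / sqrt (mink u u * mink v v)"

lemma cosh_dist_scale:
  assumes "a > 0" "b > 0"
  shows "cosh_dist (a *\<^sub>R u) (b *\<^sub>R v) = cosh_dist u v"
proof -
  have "mink (a *\<^sub>R u) (a *\<^sub>R u) * mink (b *\<^sub>R v) (b *\<^sub>R v) = (a * b)\<^sup>2 * (mink u u * mink v v)"
    by (simp add: power2_eq_square)
  then show ?thesis using assms by (simp add: cosh_dist_def real_sqrt_mult del: mink_simps) simp
qed

lemma klein_dist_eq: "klein_dist x y = arcosh (cosh_dist (homog x) (homog y))"
proof -
  have "mink (homog x) (homog x) * mink (homog y) (homog y) = (1 - x \<bullet> x) * (1 - y \<bullet> y)"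
    by (simp add: mink_homog algebra_simps)
  then show ?thesis by (simp add: klein_dist_def cosh_dist_def mink_homog)
qed

lemma cosh_dist_ge_1:
  assumes "timelike_future u" "timelike_future v"
  shows "cosh_dist u v \<ge> 1"
proof -
  have neg: "mink u v < 0" "mink u u < 0" "mink v v < 0"
    using assms timelike_future_pairing_neg by (auto simp: timelike_future_def)
  then have "mink u u * mink v v > 0" by (simp add: mult_neg_neg)
  moreover have "sqrt (mink u u * mink v v) \<le> - mink u v"
    using reversed_cauchy_schwarz[OF assms] neg(1) by (intro real_le_lsqrt) auto
  ultimately show ?thesis unfolding cosh_dist_def by (subst le_divide_eq_1_pos) auto
qed

lemma klein_dist_eq_iff:
  assumes "x \<in> klein_disc" "y \<in> klein_disc" "x' \<in> klein_disc" "y' \<in> klein_disc"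
  shows "klein_dist x y = klein_dist x' y' \<longleftrightarrow>
    cosh_dist (homog x) (homog y) = cosh_dist (homog x') (homog y')"
  unfolding klein_dist_eq using assms cosh_dist_ge_1 
  by (metis cosh_arcosh_real homog_timelike_iff)

context balanced_frame
begin

text \<open>The polar of the side opposite to vertex \<open>l\<close>.\<close>

definition side_normal :: "3 \<Rightarrow> real^3"
  where "side_normal l = comb l (-1) 1 1"

text \<open>The general formula $v - 2\,(\langle v,n\rangle / \langle n,n\rangle)\, n$, with
  $\langle n,n\rangle = 2D$ put in.\<close>

definition reflect :: "3 \<Rightarrow> real^3 \<Rightarrow> real^3"
  where "reflect l v = v - (mink v (side_normal l) / D) *\<^sub>R side_normal l"

lemma side_normal_square: "mink (side_normal l) (side_normal l) = 2 * D"
  by (simp add: side_normal_def mink_comb)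

lemma reflect_scale: "reflect l (a *\<^sub>R v) = a *\<^sub>R reflect l v"
  by (simp add: reflect_def scaleR_diff_right)

lemma reflect_comb: "reflect l (comb l x y z) = comb l (- x) (y + 2 * x) (z + 2 * x)"
  unfolding reflect_def side_normal_def mink_comb comb_arith comb_eq_iff
  using D_pos by (simp add: field_simps)

lemma mink_reflect: "mink (reflect l u) (reflect l v) = mink u v"
proof -
  obtain x y z where u: "u = comb l x y z" by (rule comb_exhaust)
  obtain x' y' z' where v: "v = comb l x' y' z'" by (rule comb_exhaust)
  show ?thesis unfolding u v reflect_comb mink_comb by (simp add: algebra_simps)
qed

lemma reflect_reflect: "reflect l (reflect l v) = v"
  by (rule comb_exhaust[of v l]) (simp add: reflect_comb)

lemma q_future: "q l $ 3 > 0"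
  using c_pos by (simp add: q_eq)

text \<open>The reflection fixes a timelike vector $w$ over the side, so it keeps the sign of the product with $w$,
  and this sign tells the two halves of the cone apart.\<close>

lemma reflect_future:
  assumes "timelike_future u"
  shows "timelike_future (reflect l u)"
proof -
  define w where "w = comb l 0 1 1"
  have "mink w w < 0" using D_pos by (simp add: w_def mink_comb)
  then have w: "timelike_future w"
    using q_future[of "l + 1"] q_future[of "l + 2"] by (simp add: timelike_future_def w_def comb_def)
  have "reflect l w = w" by (simp add: w_def reflect_comb)
  then have "mink (reflect l u) w = mink u w" by (metis mink_reflect)
  also have "\<dots> < 0" using assms w by (rule timelike_future_pairing_neg)
  finally show ?thesis
    using causal_future[OF w] assms by (simp add: timelike_future_def mink_reflect)
qed

definition klein_reflect :: "3 \<Rightarrow> real^2 \<Rightarrow> real^2"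
  where "klein_reflect l x = dehomog (reflect l (homog x))"

lemma klein_reflect_lift:
  assumes "x \<in> klein_disc"
  obtains k where "k > 0" "homog (klein_reflect l x) = k *\<^sub>R reflect l (homog x)"
proof -
  define v where "v = reflect l (homog x)"
  have "v$3 > 0"
    using reflect_future[OF homog_timelike_iff[THEN iffD2, OF assms], of l]
    by (simp only: v_def timelike_future_def)
  moreover from this have "homog (dehomog v) = inverse (v$3) *\<^sub>R v"
    by (subst (2) homog_dehomog) auto
  ultimately show thesis using that[of "inverse (v$3)"] by (simp add: klein_reflect_def v_def)
qed

lemma klein_reflect_disc:
  assumes "x \<in> klein_disc"
  shows "klein_reflect l x \<in> klein_disc"
  unfolding klein_reflect_def
  using assms by (intro timelike_future_dehomog reflect_future) (simp add: homog_timelike_iff)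

lemma klein_reflect_involution:
  assumes "x \<in> klein_disc"
  shows "klein_reflect l (klein_reflect l x) = x"
proof -
  obtain k where k: "k > 0" "homog (klein_reflect l x) = k *\<^sub>R reflect l (homog x)"
    using klein_reflect_lift[OF assms] .
  have "klein_reflect l (klein_reflect l x) = dehomog (k *\<^sub>R homog x)"
    by (subst klein_reflect_def) (simp add: k(2) reflect_scale reflect_reflect)
  then show ?thesis using k(1) by simp
qed

lemma klein_isometry_reflect: "klein_isometry (klein_reflect l)"
  unfolding klein_isometry_def
proof (intro conjI ballI)
  show "bij_betw (klein_reflect l) klein_disc klein_disc"
    by (rule bij_betw_byWitness[where f' = "klein_reflect l"])
       (auto simp: klein_reflect_involution klein_reflect_disc)
  fix x y assume xy: "x \<in> klein_disc" "y \<in> klein_disc"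
  obtain j where j: "j > 0" "homog (klein_reflect l x) = j *\<^sub>R reflect l (homog x)"
    using klein_reflect_lift[OF xy(1)] .
  obtain k where k: "k > 0" "homog (klein_reflect l y) = k *\<^sub>R reflect l (homog y)"
    using klein_reflect_lift[OF xy(2)] .
  have "cosh_dist (reflect l u) (reflect l v) = cosh_dist u v" for u v
    by (simp add: cosh_dist_def mink_reflect)
  then show "klein_dist (klein_reflect l x) (klein_reflect l y) = klein_dist x y"
    by (simp add: klein_dist_eq j k cosh_dist_scale)
qed

text \<open>A vector orthogonal to the normal is a combination $y q_{l+1} + z q_{l+2}$, and it is timelike exactly
  when $yz > 0$; being normalised to third component 1, it is then a convex combination of the two
  end points.\<close>

lemma side_iff:
  assumes "x \<in> klein_disc"
  shows "x \<in> open_segment (P (l + 1)) (P (l + 2)) \<longleftrightarrow> mink (homog x) (side_normal l) = 0"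
proof
  assume "x \<in> open_segment (P (l + 1)) (P (l + 2))"
  then obtain t where t: "x = (1 - t) *\<^sub>R P (l + 1) + t *\<^sub>R P (l + 2)" by (auto simp: in_segment)
  have "homog x = (1 - t) *\<^sub>R homog (P (l + 1)) + t *\<^sub>R homog (P (l + 2))"
    by (simp add: t vec_eq_iff forall_3)
  moreover have "mink (homog (P m)) v = mink (q m) v / c m" for m v
    using c_pos[of m] by (simp add: q_eq)
  ultimately show "mink (homog x) (side_normal l) = 0"
    by (simp add: side_normal_def mink_q_comb)
next
  assume 0: "mink (homog x) (side_normal l) = 0"
  obtain a y z where ayz: "homog x = comb l a y z" by (rule comb_exhaust)
  have "a = 0" using 0 D_pos unfolding ayz side_normal_def mink_comb by simp
  define s t where "s = y * c (l + 1)" and "t = z * c (l + 2)"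
  have h: "homog x = s *\<^sub>R homog (P (l + 1)) + t *\<^sub>R homog (P (l + 2))"
    by (simp add: ayz \<open>a = 0\<close> comb_def q_eq s_def t_def)
  have "homog x $ 3 = s + t" "homog x $ 1 = s * P (l + 1) $ 1 + t * P (l + 2) $ 1"
    "homog x $ 2 = s * P (l + 1) $ 2 + t * P (l + 2) $ 2"
    unfolding h by simp_all
  then have st: "s = 1 - t" and x: "x = s *\<^sub>R P (l + 1) + t *\<^sub>R P (l + 2)"
    by (auto simp: vec_eq_iff forall_2)
  have "mink (homog x) (homog x) < 0"
    using assms by (simp add: timelike_future_def flip: homog_timelike_iff)
  then have "y * z > 0"
    unfolding ayz mink_comb \<open>a = 0\<close> using D_pos by (simp add: zero_less_mult_iff)
  then have "s * t > 0"
    unfolding s_def t_def using c_pos[of "l + 1"] c_pos[of "l + 2"]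
    by (simp add: zero_less_mult_iff mult_less_0_iff)
  then have "0 < t" "t < 1" unfolding st by (auto simp: zero_less_mult_iff)
  moreover have "P (l + 1) \<noteq> P (l + 2)" using inj_P by (simp add: inj_eq three_arith)
  ultimately show "x \<in> open_segment (P (l + 1)) (P (l + 2))"
    unfolding in_segment using x st by blast
qed

lemma open_side_subset: "open_segment (P (l + 1)) (P (l + 2)) \<subseteq> klein_disc"
proof
  fix x assume "x \<in> open_segment (P (l + 1)) (P (l + 2))"
  then have "norm x < max (norm (P (l + 1))) (norm (P (l + 2)))"
    using dist_decreases_open_segment[of x "P (l + 1)" "P (l + 2)" 0] by (auto simp: norm_P)
  then show "x \<in> klein_disc" by (simp add: norm_P klein_disc_def)
qed

text \<open>If a point of the disc is fixed, its vector is multiplied by a positive factor under an isometry of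
  the form, and this factor is 1 because the vector is not null; so the vector itself is fixed.\<close>

lemma klein_reflection_side:
  "klein_reflection (open_segment (P (l + 1)) (P (l + 2))) (klein_reflect l)"
proof -
  have "klein_reflect l x = x \<longleftrightarrow> mink (homog x) (side_normal l) = 0" if x: "x \<in> klein_disc" for x
  proof
    assume "mink (homog x) (side_normal l) = 0"
    then show "klein_reflect l x = x" by (simp add: klein_reflect_def reflect_def)
  next
    assume fx: "klein_reflect l x = x"
    obtain k where k: "k > 0" "homog x = k *\<^sub>R reflect l (homog x)"
      using klein_reflect_lift[OF x, of l] unfolding fx .
    have "mink (homog x) (homog x) = k\<^sup>2 * mink (homog x) (homog x)"
      by (subst (1 2) k(2)) (simp add: mink_reflect power2_eq_square)
    moreover have "mink (homog x) (homog x) \<noteq> 0"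
      using x by (auto simp: timelike_future_def simp flip: homog_timelike_iff)
    ultimately have "k = 1" using k(1) by (simp add: power2_eq_1_iff)
    then have "(mink (homog x) (side_normal l) / D) *\<^sub>R side_normal l = 0"
      using k(2) by (simp add: reflect_def)
    then show "mink (homog x) (side_normal l) = 0" 
      using D_pos by (auto simp: side_normal_def)
  qed
  then show ?thesis
    unfolding klein_reflection_def using klein_isometry_reflect side_iff open_side_subset by blast
qed

lemma orthogonal_to_side:
  assumes "mink v (q (l + 1)) = 0" "mink v (q (l + 2)) = 0"
  shows "\<exists>a. v = a *\<^sub>R side_normal l"
proof -
  obtain x y z where v: "v = comb l x y z" by (rule comb_exhaust)
  have "mink (q (l + 1)) v = 0" "mink (q (l + 2)) v = 0"
    using assms mink_commute by metis+
  then have "x + z = 0" "x + y = 0"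
    using D_pos unfolding v mink_q_comb by simp_all
  then have "v = (- x) *\<^sub>R side_normal l" by (simp add: v side_normal_def comb_arith comb_eq_iff)
  then show ?thesis by blast
qed

text \<open>Let $X$ and $Z$ be the unit timelike vectors over $x$ and $f(x)$. Points of the side are fixed by $f$,
  hence equally far from $x$ and $f(x)$, so $X - Z$ is orthogonal to the side and is therefore a
  multiple $a n$ of its normal. Equality of the norms of $X$ and $Z$ leaves two values for $a$: zero,
  excluded since $f$ moves every point off the side, and the one that makes $Z$ the mirror image
  of $X$.\<close>

lemma klein_reflection_unique:
  assumes f: "klein_reflection (open_segment (P (l + 1)) (P (l + 2))) f" and x: "x \<in> klein_disc"
  shows "f x = klein_reflect l x"
proof (cases "x \<in> open_segment (P (l + 1)) (P (l + 2))")
  case True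
  then have "x \<in> {x \<in> klein_disc. f x = x}" "x \<in> {x \<in> klein_disc. klein_reflect l x = x}"
    using f klein_reflection_side[of l] unfolding klein_reflection_def by simp_all
  then show ?thesis by simp
next
  case False
  have iso: "klein_isometry f" and fix_f: "{x \<in> klein_disc. f x = x} = open_segment (P (l + 1)) (P (l + 2))"
    using f by (auto simp: klein_reflection_def)
  have fx: "f x \<in> klein_disc" and "f x \<noteq> x"
    using iso x False fix_f by (auto simp: klein_isometry_def bij_betw_def)
  define N where "N v = (1 / sqrt (- mink v v)) *\<^sub>R v" for v
  have N_unit: "mink (N v) (N v) = -1" if "timelike_future v" for v
    using that by (simp add: N_def timelike_future_def)
  have N_dehomog: "dehomog (N (homog y)) = y" if "y \<in> klein_disc" for y
    using that by (auto simp: N_def timelike_future_def simp flip: homog_timelike_iff)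
  define X Z where "X = N (homog x)" and "Z = N (homog (f x))"
  have hX: "timelike_future (homog x)" and hZ: "timelike_future (homog (f x))"
    using x fx by (simp_all add: homog_timelike_iff)
  have orth: "mink (X - Z) (homog y) = 0" if y: "y \<in> open_segment (P (l + 1)) (P (l + 2))" for y
  proof -
    have yd: "y \<in> klein_disc" and fy: "f y = y" using y fix_f by auto
    then have "klein_dist (f x) y = klein_dist x y" using iso x unfolding klein_isometry_def by metis
    then have "cosh_dist (homog (f x)) (homog y) = cosh_dist (homog x) (homog y)"
      using klein_dist_eq_iff fx x yd by blast
    moreover have "mink (N u) v = - (cosh_dist u v * sqrt (- mink v v))"
      if "timelike_future u" "timelike_future v" for u v
    proof -
      have "mink u u * mink v v = (- mink u u) * (- mink v v)" by simp
      then show ?thesis using that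
        by (simp only: cosh_dist_def real_sqrt_mult N_def mink_simps) (simp add: timelike_future_def)
    qed
    ultimately show ?thesis
      using hX hZ homog_timelike_iff[THEN iffD2, OF yd] by (simp add: X_def Z_def)
  qed
  have ne: "P (l + 1) \<noteq> P (l + 2)" using inj_P by (simp add: inj_eq three_arith)
  have comb2: "mink (X - Z) (homog (P (l + 1))) * (1 - t) + mink (X - Z) (homog (P (l + 2))) * t = 0"
    if "0 < t" "t < 1" for t
  proof -
    have h: "homog ((1 - t) *\<^sub>R P (l + 1) + t *\<^sub>R P (l + 2)) =
        (1 - t) *\<^sub>R homog (P (l + 1)) + t *\<^sub>R homog (P (l + 2))"
      by (simp add: vec_eq_iff forall_3)
    have "(1 - t) *\<^sub>R P (l + 1) + t *\<^sub>R P (l + 2) \<in> open_segment (P (l + 1)) (P (l + 2))"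
      using that ne unfolding in_segment by blast
    from orth[OF this] show ?thesis by (simp add: h mult.commute del: mink_simps(3))
  qed
  have "mink (X - Z) (homog (P (l + 1))) = 0" "mink (X - Z) (homog (P (l + 2))) = 0"
  proof -
    \<comment> \<open>Two interior points of the side suffice to reach its end points.\<close>
    define g h where "g = mink (X - Z) (homog (P (l + 1)))" and "h = mink (X - Z) (homog (P (l + 2)))"
    have "g * (1 - 1 / 2) + h * (1 / 2) = 0" "g * (1 - 1 / 3) + h * (1 / 3) = 0"
      unfolding g_def h_def by (rule comb2; simp)+
    then have "g = 0" "h = 0" by simp_all
    then show "mink (X - Z) (homog (P (l + 1))) = 0" "mink (X - Z) (homog (P (l + 2))) = 0"
      by (simp_all only: g_def h_def)
  qed
  then have "mink (X - Z) (q (l + 1)) = 0" "mink (X - Z) (q (l + 2)) = 0"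
    by (simp_all add: q_eq del: mink_simps(3))
  then obtain a where a: "X - Z = a *\<^sub>R side_normal l" using orthogonal_to_side by blast
  then have Z: "Z = X - a *\<^sub>R side_normal l" by (simp add: algebra_simps)
  have "mink Z Z = mink X X" using hX hZ by (simp add: X_def Z_def N_unit)
  then have "a * (a * D - mink X (side_normal l)) = 0"
    unfolding Z by (simp add: side_normal_square mink_commute[of "side_normal l" X] algebra_simps)
  moreover have "a \<noteq> 0"
  proof
    assume "a = 0"
    then have "N (homog (f x)) = N (homog x)" using Z by (simp add: X_def Z_def)
    then show False using N_dehomog[OF x] N_dehomog[OF fx] \<open>f x \<noteq> x\<close> by metis
  qed
  ultimately have "a = mink X (side_normal l) / D" using D_pos by (simp add: field_simps)
  then have "Z = reflect l X" unfolding reflect_def Z by simp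
  then have "f x = dehomog (reflect l X)" using N_dehomog[OF fx] by (simp add: Z_def)
  also have "\<dots> = dehomog ((1 / sqrt (- mink (homog x) (homog x))) *\<^sub>R reflect l (homog x))"
    by (simp only: X_def N_def reflect_scale)
  also have "\<dots> = klein_reflect l x"
    using hX by (simp add: klein_reflect_def dehomog_def timelike_future_def)
  finally show ?thesis .
qed

lemma hat_future: "comb l (-1) 2 2 $ 3 > 0"
proof (rule causal_future[OF center_future])
  show "mink (comb l (-1) 2 2) (comb l (-1) 2 2) \<le> 0" by (simp add: mink_comb)
  show "mink (comb l (-1) 2 2) center < 0" unfolding center_eq[of l] mink_comb using D_pos by simp
qed

lemma klein_reflect_vertex: "klein_reflect l (P l) = dehomog (comb l (-1) 2 2)"
  "reflect l (homog (P l)) = (1 / c l) *\<^sub>R comb l (-1) 2 2"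
proof -
  have "homog (P l) = (1 / c l) *\<^sub>R q l" using c_pos[of l] by (simp add: q_eq)
  then show 1: "reflect l (homog (P l)) = (1 / c l) *\<^sub>R comb l (-1) 2 2"
    by (simp add: reflect_scale q_comb(1)[of l] reflect_comb)
  show "klein_reflect l (P l) = dehomog (comb l (-1) 2 2)"
    unfolding klein_reflect_def 1 dehomog_def using c_pos[of l] by simp
qed

text \<open>The linear reflection is continuous, and dehomogenisation is continuous at the image of the vertex
  because that image is again a future null vector.\<close>

lemma klein_reflect_tendsto: "(klein_reflect l \<longlongrightarrow> klein_reflect l (P l)) (at (P l) within klein_disc)"
proof -
  have "(homog \<longlongrightarrow> homog (P l)) (at (P l) within klein_disc)"
  proof (rule vec_tendstoI)
    fix i :: 3
    show "((\<lambda>x. homog x $ i) \<longlongrightarrow> homog (P l) $ i) (at (P l) within klein_disc)"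
      using exhaust_3[of i] by (elim disjE; simp; intro tendsto_intros)
  qed
  then have R: "((\<lambda>x. reflect l (homog x) $ i) \<longlongrightarrow> reflect l (homog (P l)) $ i) (at (P l) within klein_disc)" for i
    unfolding reflect_def mink_def using D_pos by (intro tendsto_intros) auto
  have nz: "reflect l (homog (P l)) $ 3 \<noteq> 0"
    unfolding klein_reflect_vertex(2) using hat_future[of l] c_pos[of l] by simp
  show ?thesis
  proof (rule vec_tendstoI)
    fix i :: 2
    show "((\<lambda>x. klein_reflect l x $ i) \<longlongrightarrow> klein_reflect l (P l) $ i) (at (P l) within klein_disc)"
      using exhaust_2[of i] tendsto_divide[OF R R nz]
      by (auto simp: klein_reflect_def dehomog_def)
  qed
qed

lemma hat_eq: "hat P l = dehomog (comb l (-1) 2 2)"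
  unfolding hat_def reflect_ideal_def
proof (rule the_equality)
  show "\<exists>f. klein_reflection (open_segment (P (l + 1)) (P (l + 2))) f \<and>
      (f \<longlongrightarrow> dehomog (comb l (-1) 2 2)) (at (P l) within klein_disc)"
    using klein_reflection_side klein_reflect_tendsto[of l] unfolding klein_reflect_vertex by blast
  fix y assume "\<exists>f. klein_reflection (open_segment (P (l + 1)) (P (l + 2))) f \<and>
      (f \<longlongrightarrow> y) (at (P l) within klein_disc)"
  then obtain f where f: "klein_reflection (open_segment (P (l + 1)) (P (l + 2))) f"
    "(f \<longlongrightarrow> y) (at (P l) within klein_disc)" by blast
  have "\<forall>\<^sub>F x in at (P l) within klein_disc. f x = klein_reflect l x"
    using klein_reflection_unique[OF f(1)] by (simp add: eventually_at_filter)
  then have "(klein_reflect l \<longlongrightarrow> y) (at (P l) within klein_disc)"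
    using f(2) tendsto_cong by blast
  moreover have "at (P l) within klein_disc \<noteq> bot"
    by (simp add: trivial_limit_within klein_disc_def islimpt_ball norm_P)
  ultimately show "y = dehomog (comb l (-1) 2 2)"
    using tendsto_unique klein_reflect_tendsto[of l] unfolding klein_reflect_vertex by blast
qed

text \<open>The associated triangle has the same barycenter, as the sum of this frame is three times the sum of
  the original one; here the frame serves to express its polars in the original coordinates.\<close>

lemma hat_frame: "balanced_frame (hat P) (\<lambda>l. comb l (-1) 2 2) (\<lambda>l. comb l (-1) 2 2 $ 3) (9 * D)"
proof
  fix l m :: 3
  show "comb l (-1) 2 2 = comb l (-1) 2 2 $ 3 *\<^sub>R homog (hat P l)"
    unfolding hat_eq using hat_future[of l] by (intro homog_dehomog) simp
  note e = this
  have "mink (homog (hat P l)) (homog (hat P l)) = 0"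
    using arg_cong2[of _ _ _ _ mink, OF e e] hat_future[of l] by (simp add: mink_comb)
  then show "norm (hat P l) = 1" by (simp add: mink_homog norm_eq_1)
  assume "l \<noteq> m"
  then have "m = l + 1 \<or> m = l + 2" using three_cases[of l] three_cases[of m] by metis
  then show "mink (comb l (-1) 2 2) (comb m (-1) 2 2) = - (9 * D)"
    by (elim disjE) (simp_all add: comb_rotate mink_comb)
qed (use hat_future D_pos in simp_all)

lemma polar_hat_eq: "polar (hat P) l = pt (comb l (-1) (-1) 5)"
proof -
  interpret hat: balanced_frame "hat P" "\<lambda>l. comb l (-1) 2 2" "\<lambda>l. comb l (-1) 2 2 $ 3" "9 * D"
    by (rule hat_frame)
  have "hat.comb l 1 1 (-1) = comb l (-1) (-1) 5"
    unfolding hat.comb_def comb_rotate comb_arith comb_eq_iff by simp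
  then show ?thesis using hat.polar_eq by simp
qed

lemma Gamma_conic_eq_center: "Gamma_conic P = center_conic center"
  unfolding Gamma_conic_def
proof (rule the_equality)
  have "mink center center \<noteq> 0" using center_future by (auto simp: timelike_future_def)
  moreover have "polar (hat P) l \<in> center_conic center" for l
    unfolding polar_hat_eq by (subst comb_in_center_conic) simp_all
  ultimately show "conic (center_conic center) \<and> range (polar P) \<union> range (polar (hat P)) \<subseteq> center_conic center"
    using conic_center_conic polar_in_center_conic by auto
  fix C assume "conic C \<and> range (polar P) \<union> range (polar (hat P)) \<subseteq> C"
  then show "C = center_conic center"
    by (intro conic_through_polars_unique) (auto simp flip: polar_hat_eq)
qed

lemma center_homog: "center = center $ 3 *\<^sub>R homog (barycenter P)"
  unfolding barycenter_eq by (rule homog_dehomog) (use center_future in \<open>simp add: timelike_future_def\<close>)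

end

section \<open>Poncelet triangles\<close>

lemma Gamma_conic_eq:
  assumes "ideal_triangle P"
  shows "Gamma_conic P = center_conic (homog (barycenter P))"
proof -
  obtain q c D where "balanced_frame P q c D" using ideal_triangle_frame[OF assms] .
  then interpret balanced_frame P q c D .
  have "center $ 3 \<noteq> 0" using center_future by (auto simp: timelike_future_def)
  then show ?thesis using center_homog center_conic_scale Gamma_conic_eq_center by metis
qed

lemma barycenter_in_disc:
  assumes "ideal_triangle P"
  shows "barycenter P \<in> klein_disc"
proof -
  obtain q c D where "balanced_frame P q c D" using ideal_triangle_frame[OF assms] .
  then interpret balanced_frame P q c D .
  show ?thesis unfolding barycenter_eq using center_future by (rule timelike_future_dehomog)
qed

lemma polars_on_center_conic_iff:
  assumes "ideal_triangle Q" "S \<in> klein_disc"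
  shows "range (polar Q) \<subseteq> center_conic (homog S) \<longleftrightarrow> barycenter Q = S"
proof -
  obtain q c D where "balanced_frame Q q c D" using ideal_triangle_frame[OF assms(1)] .
  then interpret balanced_frame Q q c D .
  show ?thesis
  proof
    assume "range (polar Q) \<subseteq> center_conic (homog S)"
    then obtain a where a: "a \<noteq> 0" "homog S = a *\<^sub>R center"
      using center_determined_by_polars[of "homog S"] assms(2) by (auto simp: homog_timelike_iff)
    then have "center = (1 / a) *\<^sub>R homog S" by simp
    then show "barycenter Q = S" using a(1) by (simp add: barycenter_eq)
  next
    assume "barycenter Q = S"
    then have "center_conic center = center_conic (homog S)"
      using Gamma_conic_eq[OF assms(1)] Gamma_conic_eq_center by simp
    then show "range (polar Q) \<subseteq> center_conic (homog S)"
      using polar_in_center_conic by auto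
  qed
qed

lemma polar_triangle_properties:
  assumes "ideal_triangle Q"
  shows "proj_triangle (polar Q)" "circumscribed_about_absolute (polar Q)"
    "tangency_points (polar Q) = affine_pt ` range Q"
proof -
  obtain q c D where "balanced_frame Q q c D" using ideal_triangle_frame[OF assms] .
  then interpret balanced_frame Q q c D .
  show "proj_triangle (polar Q)" "circumscribed_about_absolute (polar Q)"
    "tangency_points (polar Q) = affine_pt ` range Q"
    by (rule proj_triangle_polar circumscribed_polar tangency_points_polar)+
qed

lemma polar_of_chord_commute: "polar_of_chord x y = polar_of_chord y x"
  by (simp add: polar_of_chord_def Int_commute)

text \<open>Three points have only one cyclic order up to reversal, so the set of polars depends on the vertex
  set alone.\<close>

lemma range_polar:
  assumes "inj Q"
  shows "range (polar Q) = {polar_of_chord x y | x y. x \<in> range Q \<and> y \<in> range Q \<and> x \<noteq> y}"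
proof
  show "range (polar Q) \<subseteq> {polar_of_chord x y | x y. x \<in> range Q \<and> y \<in> range Q \<and> x \<noteq> y}"
    using assms by (auto simp: polar_def inj_eq three_arith) (metis assms inj_eq three_arith(9) rangeI)
next
  show "{polar_of_chord x y | x y. x \<in> range Q \<and> y \<in> range Q \<and> x \<noteq> y} \<subseteq> range (polar Q)"
  proof clarify
    fix l m assume "Q l \<noteq> Q m"
    then have "m = l + 1 \<or> l = m + 1"
      using three_cases[of l] three_cases[of m] by metis
    then have "polar_of_chord (Q l) (Q m) = polar Q l \<or> polar_of_chord (Q l) (Q m) = polar Q m"
      using polar_of_chord_commute[of "Q l" "Q m"] unfolding polar_def by (elim disjE) simp_all
    then show "polar_of_chord (Q l) (Q m) \<in> range (polar Q)"
      by (elim disjE) simp_all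
  qed
qed

lemma endpoints_in_line_through: "X \<in> line_through X Y" "Y \<in> line_through X Y"
  by (auto simp: line_through_def intro: span_base)

text \<open>Each side is the tangent at one of three points, which must be the vertices of \<open>Q\<close> in some order. Being
  distinct, they form an ideal triangle, and a vertex of \<open>T\<close> lies on two consecutive tangents, which
  meet only in the corresponding polar.\<close>

lemma tangency_determines_triangle:
  assumes Q: "ideal_triangle Q" and T: "circumscribed_about_absolute T"
    and eq: "affine_pt ` range Q = tangency_points T"
  shows "range T = range (polar Q)"
proof -
  have "\<forall>l. \<exists>x. norm x = 1 \<and> side_line T l = polar_line (homog x)"
    using T by (simp add: circumscribed_about_absolute_def tangent_line_iff)
  then obtain t where t: "\<And>l. norm (t l) = 1" "\<And>l. side_line T l = polar_line (homog (t l))"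
    by metis
  have "tangency_points T = affine_pt ` range t"
    unfolding tangency_points_def t(2) polar_line_homog_absolute[OF t(1)] by blast
  then have ranges: "range t = range Q"
    using eq affine_pt_eq_iff by (metis inj_image_eq_iff injI)
  have "card (range t) = card (UNIV :: 3 set)"
    unfolding ranges using Q by (simp add: card_image ideal_triangle_def)
  then have inj: "inj t" by (rule eq_card_imp_inj_on[rotated]) simp
  then have "ideal_triangle t" using t(1) by (auto simp: ideal_triangle_def)
  then obtain q c D where "balanced_frame t q c D" by (rule ideal_triangle_frame)
  then interpret balanced_frame t q c D .
  have "T (l + 1) = polar t l" for l
  proof -
    have "T (l + 1) \<in> tangent_at (t l) \<inter> tangent_at (t (l + 1))"
      using endpoints_in_line_through unfolding tangent_at_eq[OF t(1)] t(2)[symmetric] side_line_def by blast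
    then show ?thesis by (simp only: tangents_meet polar_eq)
  qed
  then have "range T = range (polar t)" using range_shift3[of T] by simp
  also have "\<dots> = range (polar Q)"
    using Q inj by (simp add: range_polar ranges ideal_triangle_def)
  finally show ?thesis .
qed

theorem theorem6p3:
  fixes P :: "3 \<Rightarrow> real^2"
  assumes "ideal_triangle P"
  shows "M3 (barycenter P) =
           {range Q | Q. ideal_triangle Q \<and>
              (\<exists>T. poncelet_triangle (Gamma_conic P) T \<and>
                   affine_pt ` range Q = tangency_points T)} \<and>
         (\<forall>Q T. ideal_triangle Q \<and> poncelet_triangle (Gamma_conic P) T \<and>
            affine_pt ` range Q = tangency_points T \<longrightarrow> range T = range (polar Q)) \<and>
         (\<forall>P'. ideal_triangle P' \<and> barycenter P' = barycenter P \<longrightarrow>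
            Gamma_conic P' = Gamma_conic P)"
proof -
  define S where "S = barycenter P"
  have S: "S \<in> klein_disc" unfolding S_def using assms by (rule barycenter_in_disc)
  have G: "Gamma_conic P = center_conic (homog S)" unfolding S_def using assms by (rule Gamma_conic_eq)
  have range: "range T = range (polar Q)"
    if "ideal_triangle Q" "poncelet_triangle (Gamma_conic P) T" "affine_pt ` range Q = tangency_points T" for Q T
    using tangency_determines_triangle that by (simp add: poncelet_triangle_def)
  have iff: "(\<exists>T. poncelet_triangle (Gamma_conic P) T \<and> affine_pt ` range Q = tangency_points T) \<longleftrightarrow>
      barycenter Q = S" if Q: "ideal_triangle Q" for Q
  proof
    assume "\<exists>T. poncelet_triangle (Gamma_conic P) T \<and> affine_pt ` range Q = tangency_points T"
    then obtain T where T: "poncelet_triangle (Gamma_conic P) T" "affine_pt ` range Q = tangency_points T"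
      by blast
    then have "range (polar Q) \<subseteq> center_conic (homog S)"
      using range[OF Q T] by (simp add: poncelet_triangle_def inscribed_in_def G)
    then show "barycenter Q = S" using polars_on_center_conic_iff[OF Q S] by blast
  next
    assume "barycenter Q = S"
    then have "poncelet_triangle (Gamma_conic P) (polar Q)"
      using polars_on_center_conic_iff[OF Q S] polar_triangle_properties[OF Q]
      by (simp add: poncelet_triangle_def inscribed_in_def G)
    then show "\<exists>T. poncelet_triangle (Gamma_conic P) T \<and> affine_pt ` range Q = tangency_points T"
      using polar_triangle_properties(3)[OF Q] by metis
  qed
  have M3: "M3 (barycenter P) = {range Q | Q. ideal_triangle Q \<and>
              (\<exists>T. poncelet_triangle (Gamma_conic P) T \<and> affine_pt ` range Q = tangency_points T)}"
    unfolding M3_def S_def[symmetric] using iff by blast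
  have "Gamma_conic P' = Gamma_conic P"
    if "ideal_triangle P'" "barycenter P' = barycenter P" for P'
    using that by (simp add: Gamma_conic_eq assms)
  with M3 range show ?thesis by (intro conjI allI impI) simp_all
qed

end
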